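(* Let $d \geq 0$ be an even integer. Then the graph $G_4(d)$ has exactly one maximum independent set, i.e. $\mathrm{a}_4(d) = 1$.
   Context: For integers $n \geq 1$ and $d \geq 0$, let $S_n(d)$ be the set of monomials of degree $d$ in the polynomial ring $\mathbb{F}[x_1,\dots,x_n]$ over a field $\mathbb{F}$. The graph $G_n(d)$ has vertex set $S_n(d)$, and two monomials $f,g \in S_n(d)$ are adjacent if and only if $\mathrm{lcm}(f,g)$ has degree $d+1$. A maximum independent set is an independent set of largest possible size, and $\mathrm{a}_n(d)$ denotes the number of maximum independent sets of $G_n(d)$. *)

theory Defs
  imports "HOL-Library.Poly_Mapping"
begin

text \<open>An element of \<open>'a mpoly\<close> is a polynomial in the variables \<open>x\<^sub>0, x\<^sub>1, x\<^sub>2, \<dots>\<close>, given by its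
  coefficients; an exponent vector \<open>\<alpha> :: nat \<Rightarrow>\<^sub>0 nat\<close> stands for \<open>\<Prod>i. x\<^sub>i ^ \<alpha>\<^sub>i\<close>. The carrier set
  \<open>polys n\<close> is the ring in the variables \<open>x\<^sub>1, \<dots>, x\<^sub>n\<close>.\<close>

type_synonym 'a mpoly = "(nat \<Rightarrow>\<^sub>0 nat) \<Rightarrow>\<^sub>0 'a"

definition polys :: "nat \<Rightarrow> 'a::field mpoly set" where
  "polys n = {p. \<forall>\<alpha>\<in>Poly_Mapping.keys p. Poly_Mapping.keys \<alpha> \<subseteq> {1..n}}"

definition divides_in :: "nat \<Rightarrow> 'a::field mpoly \<Rightarrow> 'a mpoly \<Rightarrow> bool" where
  "divides_in n p q \<longleftrightarrow> (\<exists>r\<in>polys n. q = p * r)"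

definition is_lcm :: "nat \<Rightarrow> 'a::field mpoly \<Rightarrow> 'a mpoly \<Rightarrow> 'a mpoly \<Rightarrow> bool" where
  "is_lcm n f g l \<longleftrightarrow> l \<in> polys n \<and> divides_in n f l \<and> divides_in n g l \<and>
     (\<forall>m\<in>polys n. divides_in n f m \<and> divides_in n g m \<longrightarrow> divides_in n l m)"

definition monomials :: "nat \<Rightarrow> nat \<Rightarrow> 'a::field mpoly set" where
  "monomials n d = {Poly_Mapping.single \<alpha> 1 | \<alpha>.
     Poly_Mapping.keys \<alpha> \<subseteq> {1..n} \<and> (\<Sum>i=1..n. Poly_Mapping.lookup \<alpha> i) = d}"

text \<open>Adjacency in \<open>G\<^sub>n(d)\<close>. Least common multiples are unique only up to nonzero constants;
  the lcm of two monomials is normalized to be itself a monomial.\<close>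

definition adjacent :: "nat \<Rightarrow> nat \<Rightarrow> 'a::field mpoly \<Rightarrow> 'a mpoly \<Rightarrow> bool" where
  "adjacent n d f g \<longleftrightarrow> f \<in> monomials n d \<and> g \<in> monomials n d \<and>
     (\<exists>l\<in>monomials n (d + 1). is_lcm n f g l)"

definition independent_set :: "'v set \<Rightarrow> ('v \<Rightarrow> 'v \<Rightarrow> bool) \<Rightarrow> 'v set \<Rightarrow> bool" where
  "independent_set V adj I \<longleftrightarrow> I \<subseteq> V \<and> (\<forall>u\<in>I. \<forall>v\<in>I. \<not> adj u v)"

text \<open>Only meaningful for finite \<open>V\<close>, since \<open>card\<close> is \<open>0\<close> on infinite sets;
  see \<open>finite_monomials\<close> below.\<close>

definition maximum_independent_set :: "'v set \<Rightarrow> ('v \<Rightarrow> 'v \<Rightarrow> bool) \<Rightarrow> 'v set \<Rightarrow> bool" where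
  "maximum_independent_set V adj I \<longleftrightarrow>
     independent_set V adj I \<and> (\<forall>J. independent_set V adj J \<longrightarrow> card J \<le> card I)"

definition num_max_indep :: "'a::field itself \<Rightarrow> nat \<Rightarrow> nat \<Rightarrow> nat" where
  "num_max_indep _ n d =
     card {I :: 'a mpoly set. maximum_independent_set (monomials n d) (adjacent n d) I}"

lemma finite_monomials: "finite (monomials n d :: 'a::field mpoly set)"
proof -
  let ?A = "{\<alpha> :: nat \<Rightarrow>\<^sub>0 nat. Poly_Mapping.keys \<alpha> \<subseteq> {1..n} \<and> (\<Sum>i=1..n. Poly_Mapping.lookup \<alpha> i) = d}"
  have "Poly_Mapping.lookup ` ?A \<subseteq> {f. \<forall>i. (i \<in> {1..n} \<longrightarrow> f i \<in> {0..d}) \<and> (i \<notin> {1..n} \<longrightarrow> f i = 0)}"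
  proof (clarsimp, intro conjI allI impI)
    fix \<alpha> :: "nat \<Rightarrow>\<^sub>0 nat" and i
    assume "Suc 0 \<le> i \<and> i \<le> n"
    then show "Poly_Mapping.lookup \<alpha> i \<le> sum (Poly_Mapping.lookup \<alpha>) {Suc 0..n}"
      by (intro member_le_sum) auto
  next
    fix \<alpha> :: "nat \<Rightarrow>\<^sub>0 nat" and i
    assume "Poly_Mapping.keys \<alpha> \<subseteq> {Suc 0..n}" "Suc 0 \<le> i \<longrightarrow> \<not> i \<le> n"
    then show "Poly_Mapping.lookup \<alpha> i = 0" by (auto simp: in_keys_iff)
  qed
  moreover have "finite {f::nat\<Rightarrow>nat. \<forall>i. (i \<in> {1..n} \<longrightarrow> f i \<in> {0..d}) \<and> (i \<notin> {1..n} \<longrightarrow> f i = 0)}"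
    by (rule finite_set_of_finite_funs) auto
  ultimately have "finite (Poly_Mapping.lookup ` ?A)" by (rule finite_subset)
  then have "finite ?A" by (rule finite_imageD) (rule inj_onI, simp only: poly_mapping_eq_iff)
  then have "finite ((\<lambda>\<alpha>. Poly_Mapping.single \<alpha> (1::'a)) ` ?A)" by (rule finite_imageI)
  then show ?thesis unfolding monomials_def by (simp add: setcompr_eq_image)
qed

text \<open>Divisibility by a monomial, and hence adjacency, in terms of exponent vectors.\<close>

lemma divides_in_single_iff:
  fixes m :: "'a::field mpoly"
  assumes m: "m \<in> polys n"
  shows "divides_in n (Poly_Mapping.single \<alpha> 1) m \<longleftrightarrow>
    (\<forall>\<kappa>\<in>Poly_Mapping.keys m. \<forall>i. Poly_Mapping.lookup \<alpha> i \<le> Poly_Mapping.lookup \<kappa> i)"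
    (is "?L \<longleftrightarrow> ?R")
proof
  assume ?L
  then obtain r where "m = Poly_Mapping.single \<alpha> 1 * r" by (auto simp: divides_in_def)
  then have "Poly_Mapping.keys m \<subseteq> {\<alpha> + b | b. b \<in> Poly_Mapping.keys r}"
    using keys_mult[of "Poly_Mapping.single \<alpha> (1::'a)" r] by auto
  then show ?R by (auto simp: lookup_add)
next
  assume R: ?R
  define r where "r = (\<Sum>\<kappa>\<in>Poly_Mapping.keys m. Poly_Mapping.single (\<kappa> - \<alpha>) (Poly_Mapping.lookup m \<kappa>))"
  have "Poly_Mapping.keys (\<kappa> - \<alpha>) \<subseteq> Poly_Mapping.keys \<kappa>" for \<kappa>
    by (auto simp: in_keys_iff lookup_minus)
  moreover have "Poly_Mapping.keys r \<subseteq> (\<lambda>\<kappa>. \<kappa> - \<alpha>) ` Poly_Mapping.keys m"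
  proof
    fix \<gamma> assume "\<gamma> \<in> Poly_Mapping.keys r"
    then have "(\<Sum>\<kappa>\<in>Poly_Mapping.keys m.
        Poly_Mapping.lookup (Poly_Mapping.single (\<kappa> - \<alpha>) (Poly_Mapping.lookup m \<kappa>)) \<gamma>) \<noteq> 0"
      by (simp add: in_keys_iff r_def lookup_sum)
    then obtain \<kappa> where "\<kappa> \<in> Poly_Mapping.keys m"
      "Poly_Mapping.lookup (Poly_Mapping.single (\<kappa> - \<alpha>) (Poly_Mapping.lookup m \<kappa>)) \<gamma> \<noteq> 0"
      by (rule sum.not_neutral_contains_not_neutral)
    then show "\<gamma> \<in> (\<lambda>\<kappa>. \<kappa> - \<alpha>) ` Poly_Mapping.keys m"
      by (auto simp: lookup_single when_def split: if_splits)
  qed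
  ultimately have "r \<in> polys n" using m unfolding polys_def by fast
  moreover have "m = Poly_Mapping.single \<alpha> 1 * r"
  proof -
    have "\<alpha> + (\<kappa> - \<alpha>) = \<kappa>" if "\<kappa> \<in> Poly_Mapping.keys m" for \<kappa>
      using R that by (intro poly_mapping_eqI) (auto simp: lookup_add lookup_minus)
    then have "Poly_Mapping.single \<alpha> 1 * r =
        (\<Sum>\<kappa>\<in>Poly_Mapping.keys m. Poly_Mapping.single \<kappa> (Poly_Mapping.lookup m \<kappa>))"
      unfolding r_def sum_distrib_left by (intro sum.cong) (auto simp: mult_single)
    also have "\<dots> = m"
    proof (rule poly_mapping_eqI)
      fix \<gamma>
      show "Poly_Mapping.lookup (\<Sum>\<kappa>\<in>Poly_Mapping.keys m. Poly_Mapping.single \<kappa> (Poly_Mapping.lookup m \<kappa>)) \<gamma>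
          = Poly_Mapping.lookup m \<gamma>"
        unfolding lookup_sum lookup_single when_def
        by (subst sum.delta) (simp_all add: in_keys_iff)
    qed
    finally show ?thesis by simp
  qed
  ultimately show ?L by (auto simp: divides_in_def)
qed

lemma adjacent_iff:
  fixes \<alpha> \<beta> :: "nat \<Rightarrow>\<^sub>0 nat"
  assumes f: "Poly_Mapping.single \<alpha> 1 \<in> (monomials n d :: 'a::field mpoly set)"
    and g: "Poly_Mapping.single \<beta> 1 \<in> (monomials n d :: 'a mpoly set)"
  shows "adjacent n d (Poly_Mapping.single \<alpha> (1::'a)) (Poly_Mapping.single \<beta> 1) \<longleftrightarrow>
    (\<Sum>i=1..n. max (Poly_Mapping.lookup \<alpha> i) (Poly_Mapping.lookup \<beta> i)) = d + 1"
proof -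
  define \<mu> where "\<mu> = \<alpha> + (\<beta> - \<alpha>)"
  have mu: "Poly_Mapping.lookup \<mu> i = max (Poly_Mapping.lookup \<alpha> i) (Poly_Mapping.lookup \<beta> i)" for i
    by (simp add: \<mu>_def lookup_add lookup_minus)
  have inj: "Poly_Mapping.single x (1::'a) = Poly_Mapping.single y 1 \<longleftrightarrow> x = y" for x y :: "nat \<Rightarrow>\<^sub>0 nat"
    by (metis keys_single one_neq_zero singleton_inject)
  have ab: "Poly_Mapping.keys \<alpha> \<subseteq> {1..n}" "Poly_Mapping.keys \<beta> \<subseteq> {1..n}"
    using f g by (auto simp: monomials_def inj)
  have kmu: "Poly_Mapping.keys \<mu> \<subseteq> {1..n}"
  proof
    fix i assume "i \<in> Poly_Mapping.keys \<mu>"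
    then have "i \<in> Poly_Mapping.keys \<alpha> \<or> i \<in> Poly_Mapping.keys \<beta>"
      by (simp add: in_keys_iff mu max_def split: if_splits)
    then show "i \<in> {1..n}" using ab by blast
  qed
  have sP: "Poly_Mapping.single x 1 \<in> (polys n :: 'a mpoly set) \<longleftrightarrow> Poly_Mapping.keys x \<subseteq> {1..n}" for x
    by (simp add: polys_def)
  have lcm: "is_lcm n (Poly_Mapping.single \<alpha> (1::'a)) (Poly_Mapping.single \<beta> 1) (Poly_Mapping.single x 1)
      \<longleftrightarrow> x = \<mu>" if x: "Poly_Mapping.keys x \<subseteq> {1..n}" for x
  proof
    assume L: "is_lcm n (Poly_Mapping.single \<alpha> (1::'a)) (Poly_Mapping.single \<beta> 1) (Poly_Mapping.single x 1)"
    then have "\<forall>i. Poly_Mapping.lookup \<alpha> i \<le> Poly_Mapping.lookup x i"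
      "\<forall>i. Poly_Mapping.lookup \<beta> i \<le> Poly_Mapping.lookup x i"
      by (auto simp: is_lcm_def divides_in_single_iff)
    moreover have "divides_in n (Poly_Mapping.single x (1::'a)) (Poly_Mapping.single \<mu> 1)"
    proof -
      have "divides_in n (Poly_Mapping.single \<alpha> (1::'a)) (Poly_Mapping.single \<mu> 1)"
        "divides_in n (Poly_Mapping.single \<beta> (1::'a)) (Poly_Mapping.single \<mu> 1)"
        using kmu by (simp_all add: divides_in_single_iff sP mu)
      then show ?thesis using L kmu sP unfolding is_lcm_def by blast
    qed
    then have "\<forall>i. Poly_Mapping.lookup x i \<le> Poly_Mapping.lookup \<mu> i"
      using kmu by (simp add: divides_in_single_iff sP)
    ultimately show "x = \<mu>" by (intro poly_mapping_eqI order_antisym) (auto simp: mu)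
  next
    assume "x = \<mu>"
    then show "is_lcm n (Poly_Mapping.single \<alpha> (1::'a)) (Poly_Mapping.single \<beta> 1) (Poly_Mapping.single x 1)"
      using kmu by (simp add: is_lcm_def divides_in_single_iff sP mu)
  qed
  have "adjacent n d (Poly_Mapping.single \<alpha> (1::'a)) (Poly_Mapping.single \<beta> 1) \<longleftrightarrow>
     (\<exists>x. Poly_Mapping.keys x \<subseteq> {1..n} \<and> (\<Sum>i=1..n. Poly_Mapping.lookup x i) = d + 1 \<and> x = \<mu>)"
    (is "_ \<longleftrightarrow> ?R")
  proof
    assume "adjacent n d (Poly_Mapping.single \<alpha> (1::'a)) (Poly_Mapping.single \<beta> 1)"
    then show ?R using lcm unfolding adjacent_def monomials_def by blast
  next
    assume ?R
    then show "adjacent n d (Poly_Mapping.single \<alpha> (1::'a)) (Poly_Mapping.single \<beta> 1)"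
      using f g lcm unfolding adjacent_def by (fastforce simp: monomials_def)
  qed
  then show ?thesis using kmu by (simp add: mu)
qed

end

theory Submission
  imports Defs
begin

text \<open>Let \<open>d = 2 * k\<close>. The unique maximum independent set consists of the exponent vectors
  \<open>(a, b, c, e)\<close> whose entries all have the same parity. The layers \<open>e \<le> 1\<close> are covered by cliques,
  one for each vector of that set in these layers; so an independent set has at most as many points there as
  the parity set, and the layers \<open>e \<ge> 2\<close> are a copy of \<open>G\<^sub>4(d - 2)\<close>. By induction a maximum
  independent set agrees with the parity set wherever \<open>e \<ge> 2\<close>, hence by symmetry wherever some entry
  is at least \<open>2\<close>; the few remaining vectors occur only for \<open>d \<le> 4\<close>.\<close>

section \<open>Exponent quadruples and the parity set\<close>

type_synonym quad = "nat \<times> nat \<times> nat \<times> nat"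

fun weight :: "quad \<Rightarrow> nat" where
  "weight (a, b, c, e) = a + b + c + e"

fun qle :: "quad \<Rightarrow> quad \<Rightarrow> bool" where
  "qle (a, b, c, e) (a', b', c', e') \<longleftrightarrow> a \<le> a' \<and> b \<le> b' \<and> c \<le> c' \<and> e \<le> e'"

text \<open>The lcm condition on exponents, with the degree read off the first argument; it is meant
  for two vectors of equal weight, where it is symmetric.\<close>

fun qadj :: "quad \<Rightarrow> quad \<Rightarrow> bool" where
  "qadj (a, b, c, e) (a', b', c', e') \<longleftrightarrow>
     max a a' + max b b' + max c c' + max e e' = Suc (a + b + c + e)"

fun same_parity :: "quad \<Rightarrow> bool" where
  "same_parity (a, b, c, e) \<longleftrightarrow> even a = even b \<and> even b = even c \<and> even c = even e"

definition quads :: "nat \<Rightarrow> quad set" where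
  "quads d = {v. weight v = d}"

definition parity_set :: "nat \<Rightarrow> quad set" where
  "parity_set d = {v \<in> quads d. same_parity v}"

lemma finite_quads: "finite (quads d)"
proof (rule finite_subset)
  show "quads d \<subseteq> {..d} \<times> {..d} \<times> {..d} \<times> {..d}"
    by (auto simp: quads_def)
qed auto

text \<open>Adjacent vectors of equal weight differ by moving one unit between two coordinates, so
  two of the four differences are odd and two are zero. Inside the parity set the differences are
  all even or all odd.\<close>

lemma independent_parity_set: "independent_set (quads d) qadj (parity_set d)"
proof -
  have "\<not> qadj u v" if "u \<in> parity_set d" "v \<in> parity_set d" for u v
  proof (cases u; cases v)
    fix a b c e a' b' c' e'
    assume u: "u = (a, b, c, e)" and v: "v = (a', b', c', e')"
    show ?thesis
    proof
      assume "qadj u v"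
      then have *: "max a a' + max b b' + max c c' + max e e' = Suc (a + b + c + e)"
        "a + b + c + e = a' + b' + c' + e'"
        using that by (auto simp: u v parity_set_def quads_def)
      \<comment> \<open>With truncated subtraction, \<open>max x y\<close> is
        \<open>x + (y - x)\<close>; the equal weights give the second equation.\<close>
      then have "(a' - a) + (b' - b) + (c' - c) + (e' - e) = 1"
        "(a - a') + (b - b') + (c - c') + (e - e') = 1"
        by linarith+
      note diffs = this
      have "even (a + a') = even (b + b')" "even (b + b') = even (c + c')"
        "even (c + c') = even (e + e')"
        using that by (auto simp: u v parity_set_def)
      then consider (ev) "even (a + a')" "even (b + b')" "even (c + c')" "even (e + e')"
        | (od) "odd (a + a')" "odd (b + b')" "odd (c + c')" "odd (e + e')"
        by blast
      then show False
      proof cases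
        case ev
        then have "even (a' - a)" "even (b' - b)" "even (c' - c)" "even (e' - e)"
          by (simp_all add: add.commute)
        then have "even ((a' - a) + (b' - b) + (c' - c) + (e' - e))" by simp
        with diffs(1) show False by simp
      next
        case od
        have "x \<noteq> y" if "odd (x + y)" for x y :: nat
          using that by auto
        \<comment> \<open>Four odd differences contribute at least 4, while \<open>diffs\<close>
          allows a total of 2.\<close>
        then have "(x - y) + (y - x) \<ge> 1" if "odd (x + y)" for x y :: nat
          using that by (metis One_nat_def Suc_leI add_is_0 diffs0_imp_equal gr0I)
        note this[OF od(1)] this[OF od(2)] this[OF od(3)] this[OF od(4)]
        with diffs show False by linarith
      qed
    qed
  qed
  then show ?thesis
    by (auto simp: independent_set_def parity_set_def)
qed

section \<open>Covering the two lowest layers by cliques\<close>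

text \<open>As monomials: the products of \<open>m\<close> with a single variable.\<close>

definition up_clique :: "quad \<Rightarrow> quad set" where
  "up_clique m = {v. qle m v \<and> weight v = Suc (weight m)}"

text \<open>As monomials: the quotients of \<open>m\<close> by a single variable; any two different
  ones have lcm \<open>m\<close>.\<close>

definition down_clique :: "quad \<Rightarrow> quad set" where
  "down_clique m = {v. qle v m \<and> weight m = Suc (weight v)}"

lemma up_clique_adj: "u \<in> up_clique m \<Longrightarrow> v \<in> up_clique m \<Longrightarrow> u = v \<or> qadj u v"
  by (cases u; cases v; cases m) (auto simp: up_clique_def)

lemma down_clique_adj: "u \<in> down_clique m \<Longrightarrow> v \<in> down_clique m \<Longrightarrow> u = v \<or> qadj u v"
  by (cases u; cases v; cases m) (auto simp: down_clique_def)

text \<open>The covering cliques of the layers \<open>e \<le> 1\<close>. They are used with \<open>t\<close> the largest even number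
  at most \<open>k\<close>: the three corner regions, in which one of \<open>a\<close>, \<open>b\<close>, \<open>c\<close> exceeds \<open>t\<close>, are tiled
  in the direction of their corner, and the central region in the direction of the last coordinate.\<close>

fun clique_at :: "nat \<Rightarrow> quad \<Rightarrow> quad set" where
  "clique_at t (a, b, c, e) =
    (if e = 0 then
       if a > t then up_clique (a - 1, b, c, e)
       else if b > t then up_clique (a, b - 1, c, e)
       else if c > t then up_clique (a, b, c - 1, e)
       else down_clique (a, b, c, e + 1)
     else
       if a > t then down_clique (a + 1, b, c, e)
       else if b > t then down_clique (a, b + 1, c, e)
       else if c > t then down_clique (a, b, c + 1, e)
       else up_clique (a, b, c, e - 1))"

lemma clique_at_adj: "u \<in> clique_at t p \<Longrightarrow> v \<in> clique_at t p \<Longrightarrow> u = v \<or> qadj u v"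
  by (cases p) (auto split: if_splits dest: up_clique_adj down_clique_adj)

definition low :: "quad set" where
  "low = {(a, b, c, e). e \<le> 1}"

text \<open>No point of the parity set has two coordinates exceeding \<open>t\<close>, so the order of the case
  distinctions in \<open>clique_at\<close> is immaterial.\<close>

lemma clique_at_even:
  assumes "even a" "even b" "even c" "even t" "a + b + c = 2 * k" "k \<le> t + 1"
  shows "a > t \<Longrightarrow> clique_at t (a, b, c, 0) = up_clique (a - 1, b, c, 0)"
    and "b > t \<Longrightarrow> clique_at t (a, b, c, 0) = up_clique (a, b - 1, c, 0)"
    and "c > t \<Longrightarrow> clique_at t (a, b, c, 0) = up_clique (a, b, c - 1, 0)"
    and "a \<le> t \<Longrightarrow> b \<le> t \<Longrightarrow> c \<le> t \<Longrightarrow> clique_at t (a, b, c, 0) = down_clique (a, b, c, 1)"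
proof -
  \<comment> \<open>Two even coordinates above \<open>t\<close> would add up to at least
    \<open>2 * t + 4\<close>, which exceeds \<open>2 * k\<close>.\<close>
  have gap: "x > t \<Longrightarrow> x \<ge> t + 2" if "even x" for x
    using that \<open>even t\<close> by presburger
  note g = gap[OF \<open>even a\<close>] gap[OF \<open>even b\<close>] gap[OF \<open>even c\<close>]
  show "a > t \<Longrightarrow> clique_at t (a, b, c, 0) = up_clique (a - 1, b, c, 0)"
    "b > t \<Longrightarrow> clique_at t (a, b, c, 0) = up_clique (a, b - 1, c, 0)"
    "c > t \<Longrightarrow> clique_at t (a, b, c, 0) = up_clique (a, b, c - 1, 0)"
    "a \<le> t \<Longrightarrow> b \<le> t \<Longrightarrow> c \<le> t \<Longrightarrow> clique_at t (a, b, c, 0) = down_clique (a, b, c, 1)"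
    using g assms(5,6) by auto
qed

text \<open>Two coordinates above \<open>t\<close>, a positive third one and the last coordinate 1
  would add up to at least \<open>2 * t + 4\<close>, again more than \<open>2 * k\<close>.\<close>

lemma clique_at_odd:
  assumes "odd a" "odd b" "odd c" "a + b + c + 1 = 2 * k" "k \<le> t + 1"
  shows "a > t \<Longrightarrow> clique_at t (a, b, c, 1) = down_clique (a + 1, b, c, 1)"
    and "b > t \<Longrightarrow> clique_at t (a, b, c, 1) = down_clique (a, b + 1, c, 1)"
    and "c > t \<Longrightarrow> clique_at t (a, b, c, 1) = down_clique (a, b, c + 1, 1)"
    and "a \<le> t \<Longrightarrow> b \<le> t \<Longrightarrow> c \<le> t \<Longrightarrow> clique_at t (a, b, c, 1) = up_clique (a, b, c, 0)"
proof -
  note g = odd_pos[OF \<open>odd a\<close>] odd_pos[OF \<open>odd b\<close>] odd_pos[OF \<open>odd c\<close>]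
  show "a > t \<Longrightarrow> clique_at t (a, b, c, 1) = down_clique (a + 1, b, c, 1)"
    "b > t \<Longrightarrow> clique_at t (a, b, c, 1) = down_clique (a, b + 1, c, 1)"
    "c > t \<Longrightarrow> clique_at t (a, b, c, 1) = down_clique (a, b, c + 1, 1)"
    "a \<le> t \<Longrightarrow> b \<le> t \<Longrightarrow> c \<le> t \<Longrightarrow> clique_at t (a, b, c, 1) = up_clique (a, b, c, 0)"
    using g assms(4,5) by auto
qed

declare clique_at.simps [simp del]

text \<open>The weight is even, so the parities of \<open>a\<close>, \<open>b\<close>,
  \<open>c\<close> leave four patterns in each layer. A vector of the parity set lies in its own
  clique; any other one is a unit move away from a suitable parity vector, chosen according to the
  region.\<close>

lemma low_cover:
  assumes v: "v \<in> quads (2 * k)" "v \<in> low"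
  shows "\<exists>p \<in> parity_set (2 * k) \<inter> low. v \<in> clique_at (2 * (k div 2)) p"
proof -
  define t where "t = 2 * (k div 2)"
  have t: "even t" "k \<le> t + 1" "t \<le> k" by (auto simp: t_def)
  have gap: "t + 1 < x \<or> x \<le> t" if "even x" for x
    using that \<open>even t\<close> by presburger
  obtain a b c e where abce: "v = (a, b, c, e)" by (cases v)
  then have sum: "a + b + c + e = 2 * k" and "e \<le> 1"
    using v by (auto simp: quads_def low_def)
  \<comment> \<open>\<open>evI\<close> and \<open>odI\<close> reduce the goal to naming a parity
    vector in layer 0 or in layer 1.\<close>
  have evI: ?thesis
    if "v \<in> clique_at t (x, y, z, 0)" "even x" "even y" "even z" "x + y + z = 2 * k" for x y z
    using that by (intro bexI[of _ "(x, y, z, 0)"]) (auto simp: t_def parity_set_def quads_def low_def)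
  have odI: ?thesis
    if "v \<in> clique_at t (x, y, z, 1)" "odd x" "odd y" "odd z" "x + y + z + 1 = 2 * k" for x y z
    using that by (intro bexI[of _ "(x, y, z, 1)"]) (auto simp: t_def parity_set_def quads_def low_def)
  note ce = clique_at_even[OF _ _ _ t(1) _ t(2)]
  note co = clique_at_odd[OF _ _ _ _ t(2), unfolded One_nat_def]
  note defs = up_clique_def down_clique_def abce
  consider (layer0) "e = 0" | (layer1) "e = 1" using \<open>e \<le> 1\<close> by linarith
  then show ?thesis
  proof cases
    case layer0
    note [simp] = layer0
    have s: "a + b + c = 2 * k" using sum by simp
    then have "even (a + b + c)" by simp
    then consider (none) "even a" "even b" "even c" | (ab) "odd a" "odd b" "even c"
      | (ac) "odd a" "even b" "odd c" | (bc) "even a" "odd b" "odd c" by auto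
    then show ?thesis
    proof cases
      case none
      then show ?thesis using s t
        by (intro evI[of a b c]) (auto simp: defs clique_at.simps)
    next
      case ab
      have pos: "a \<ge> 1" "b \<ge> 1" using ab by (simp_all add: Suc_le_eq odd_pos)
      \<comment> \<open>The three corners and the centre. The even \<open>c\<close> cannot equal
        \<open>t + 1\<close>, so the cases are exhaustive.\<close>
      consider "a + 1 > t" | "b + 1 > t" | "c > t + 1" | "a + 1 \<le> t" "b + 1 \<le> t" "c \<le> t"
        using gap[OF ab(3)] by linarith
      then show ?thesis
      proof cases
        case 1
        then show ?thesis using ab s t pos
          by (intro evI[of "a + 1" "b - 1" c]) (auto simp: defs ce)
      next
        case 2
        then show ?thesis using ab s t pos
          by (intro evI[of "a - 1" "b + 1" c]) (auto simp: defs ce)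
      next
        case 3
        then show ?thesis using ab s t pos
          by (intro odI[of a b "c - 1"]) (auto simp: defs co)
      next
        case 4
        \<comment> \<open>Here \<open>a + b\<close> is at most \<open>2 * t - 2\<close>, hence below
          \<open>2 * k\<close>.\<close>
        then have "c \<ge> 1" using s t by linarith
        with 4 show ?thesis using ab s t pos
          by (intro odI[of a b "c - 1"]) (auto simp: defs co)
      qed
    next
      case ac
      have pos: "a \<ge> 1" "c \<ge> 1" using ac by (simp_all add: Suc_le_eq odd_pos)
      consider "a + 1 > t" | "c + 1 > t" | "b > t + 1" | "a + 1 \<le> t" "c + 1 \<le> t" "b \<le> t"
        using gap[OF ac(2)] by linarith
      then show ?thesis
      proof cases
        case 1
        then show ?thesis using ac s t pos
          by (intro evI[of "a + 1" b "c - 1"]) (auto simp: defs ce)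
      next
        case 2
        then show ?thesis using ac s t pos
          by (intro evI[of "a - 1" b "c + 1"]) (auto simp: defs ce)
      next
        case 3
        then show ?thesis using ac s t pos
          by (intro odI[of a "b - 1" c]) (auto simp: defs co)
      next
        case 4
        then have "b \<ge> 1" using s t by linarith
        with 4 show ?thesis using ac s t pos
          by (intro odI[of a "b - 1" c]) (auto simp: defs co)
      qed
    next
      case bc
      have pos: "b \<ge> 1" "c \<ge> 1" using bc by (simp_all add: Suc_le_eq odd_pos)
      consider "b + 1 > t" | "c + 1 > t" | "a > t + 1" | "b + 1 \<le> t" "c + 1 \<le> t" "a \<le> t"
        using gap[OF bc(1)] by linarith
      then show ?thesis
      proof cases
        case 1
        then show ?thesis using bc s t pos
          by (intro evI[of a "b + 1" "c - 1"]) (auto simp: defs ce)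
      next
        case 2
        then show ?thesis using bc s t pos
          by (intro evI[of a "b - 1" "c + 1"]) (auto simp: defs ce)
      next
        case 3
        then show ?thesis using bc s t pos
          by (intro odI[of "a - 1" b c]) (auto simp: defs co)
      next
        case 4
        then have "a \<ge> 1" using s t by linarith
        with 4 show ?thesis using bc s t pos
          by (intro odI[of "a - 1" b c]) (auto simp: defs co)
      qed
    qed
  next
    case layer1
    note [simp] = layer1
    have s: "a + b + c + 1 = 2 * k" using sum by simp
    then have "odd (a + b + c)" by presburger
    then consider (all) "odd a" "odd b" "odd c" | (a) "odd a" "even b" "even c"
      | (b) "even a" "odd b" "even c" | (c) "even a" "even b" "odd c" by auto
    then show ?thesis
    proof cases
      case all
      then show ?thesis using s t
        by (intro odI[of a b c]) (auto simp: defs clique_at.simps)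
    next
      case a
      consider "a + 1 > t" | "b > t + 1" | "c > t + 1" | "a + 1 \<le> t" "b \<le> t" "c \<le> t"
        using gap[OF a(2)] gap[OF a(3)] by linarith
      then show ?thesis
      proof cases
        case 1
        then show ?thesis using a s t
          by (intro evI[of "a + 1" b c]) (auto simp: defs ce)
      next
        case 2
        then show ?thesis using a s t
          by (intro odI[of a "b - 1" "c + 1"]) (auto simp: defs co)
      next
        case 3
        then show ?thesis using a s t
          by (intro odI[of a "b + 1" "c - 1"]) (auto simp: defs co)
      next
        \<comment> \<open>The witness of the first case returns, but now as a central point, whose
          clique points downwards.\<close>
        case 4
        then show ?thesis using a s t
          by (intro evI[of "a + 1" b c]) (auto simp: defs ce)
      qed
    next
      case b
      consider "b + 1 > t" | "a > t + 1" | "c > t + 1" | "b + 1 \<le> t" "a \<le> t" "c \<le> t"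
        using gap[OF b(1)] gap[OF b(3)] by linarith
      then show ?thesis
      proof cases
        case 1
        then show ?thesis using b s t
          by (intro evI[of a "b + 1" c]) (auto simp: defs ce)
      next
        case 2
        then show ?thesis using b s t
          by (intro odI[of "a - 1" b "c + 1"]) (auto simp: defs co)
      next
        case 3
        then show ?thesis using b s t
          by (intro odI[of "a + 1" b "c - 1"]) (auto simp: defs co)
      next
        case 4
        then show ?thesis using b s t
          by (intro evI[of a "b + 1" c]) (auto simp: defs ce)
      qed
    next
      case c
      consider "c + 1 > t" | "a > t + 1" | "b > t + 1" | "c + 1 \<le> t" "a \<le> t" "b \<le> t"
        using gap[OF c(1)] gap[OF c(2)] by linarith
      then show ?thesis
      proof cases
        case 1
        then show ?thesis using c s t
          by (intro evI[of a b "c + 1"]) (auto simp: defs ce)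
      next
        case 2
        then show ?thesis using c s t
          by (intro odI[of "a - 1" "b + 1" c]) (auto simp: defs co)
      next
        case 3
        then show ?thesis using c s t
          by (intro odI[of "a + 1" "b - 1" c]) (auto simp: defs co)
      next
        case 4
        then show ?thesis using c s t
          by (intro evI[of a b "c + 1"]) (auto simp: defs ce)
      qed
    qed
  qed
qed

text \<open>A clique meets an independent set at most once, so sending each point to the parity
  vector of a clique containing it is injective.\<close>

lemma card_low_le:
  assumes I: "independent_set (quads (2 * k)) qadj I"
  shows "card (I \<inter> low) \<le> card (parity_set (2 * k) \<inter> low)"
proof -
  have "\<forall>v \<in> I \<inter> low. \<exists>p. p \<in> parity_set (2 * k) \<inter> low \<and> v \<in> clique_at (2 * (k div 2)) p"
  proof
    fix v assume "v \<in> I \<inter> low"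
    then have "v \<in> quads (2 * k)" "v \<in> low" using I by (auto simp: independent_set_def)
    from low_cover[OF this] show "\<exists>p. p \<in> parity_set (2 * k) \<inter> low \<and> v \<in> clique_at (2 * (k div 2)) p"
      by blast
  qed
  then obtain f where f: "\<And>v. v \<in> I \<inter> low \<Longrightarrow> f v \<in> parity_set (2 * k) \<inter> low"
    "\<And>v. v \<in> I \<inter> low \<Longrightarrow> v \<in> clique_at (2 * (k div 2)) (f v)"
    by metis
  have "inj_on f (I \<inter> low)"
  proof (rule inj_onI)
    fix u v assume uv: "u \<in> I \<inter> low" "v \<in> I \<inter> low" "f u = f v"
    then have "u = v \<or> qadj u v" using f(2) clique_at_adj by metis
    then show "u = v" using uv I by (auto simp: independent_set_def)
  qed
  moreover have "finite (parity_set (2 * k) \<inter> low)"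
    using finite_quads by (auto simp: parity_set_def)
  ultimately show ?thesis
    using f(1) by (intro card_inj_on_le[of f]) auto
qed

section \<open>The shift by two and the coordinate swaps\<close>

fun lift2 :: "quad \<Rightarrow> quad" where
  "lift2 (a, b, c, e) = (a, b, c, e + 2)"

lemma inj_lift2: "inj lift2"
  by (auto intro!: injI)

lemma weight_lift2 [simp]: "weight (lift2 v) = weight v + 2"
  by (cases v) simp

lemma qadj_lift2 [simp]: "qadj (lift2 u) (lift2 v) \<longleftrightarrow> qadj u v"
  by (cases u; cases v) (simp only: lift2.simps qadj.simps max_add_distrib_left[symmetric], linarith)

lemma same_parity_lift2 [simp]: "same_parity (lift2 v) \<longleftrightarrow> same_parity v"
  by (cases v) simp

lemma range_lift2: "range lift2 = - low"
proof
  show "- low \<subseteq> range lift2"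
  proof
    fix v assume "v \<in> - low"
    moreover obtain a b c e where "v = (a, b, c, e)" by (cases v)
    ultimately have "v = lift2 (a, b, c, e - 2)" by (auto simp: low_def)
    then show "v \<in> range lift2" by blast
  qed
qed (auto simp: low_def)

lemma parity_set_Suc: "lift2 -` parity_set (2 * Suc k) = parity_set (2 * k)"
  by (auto simp: parity_set_def quads_def)

definition weight_symmetry :: "(quad \<Rightarrow> quad) \<Rightarrow> bool" where
  "weight_symmetry s \<longleftrightarrow> (\<forall>v. s (s v) = v \<and> weight (s v) = weight v \<and> same_parity (s v) = same_parity v)
     \<and> (\<forall>u v. qadj (s u) (s v) = qadj u v)"

text \<open>Each coordinate can be brought to the last place by one of these maps, the identity
  serving the last coordinate itself.\<close>

lemma weight_symmetry_swaps:
  "weight_symmetry (\<lambda>v. v)"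
  "weight_symmetry (\<lambda>(a, b, c, e). (e, b, c, a))"
  "weight_symmetry (\<lambda>(a, b, c, e). (a, e, c, b))"
  "weight_symmetry (\<lambda>(a, b, c, e). (a, b, e, c))"
  unfolding weight_symmetry_def
  by (simp_all only: split_paired_All prod.case weight.simps same_parity.simps qadj.simps add_ac) blast+

section \<open>Uniqueness by induction on half the degree\<close>

text \<open>Assuming only a lower bound on \<open>card I\<close> yields both facts needed later: no
  independent set is larger than the parity set, and none of the same size differs from it.\<close>

lemma independent_parity_unique:
  assumes "independent_set (quads (2 * k)) qadj I" "card (parity_set (2 * k)) \<le> card I"
  shows "I = parity_set (2 * k)"
  using assms
proof (induction k arbitrary: I)
  case 0
  have "parity_set 0 = quads 0" by (auto simp: parity_set_def quads_def)
  then show ?case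
    using 0 finite_quads[of 0] card_seteq[of "quads 0" I] by (simp add: independent_set_def)
next
  case (Suc k)
  let ?P = "parity_set (2 * Suc k)"
  have finP: "finite ?P" using finite_quads by (auto simp: parity_set_def)
  have split: "card X = card (X \<inter> low) + card (lift2 -` X)" if "finite X" for X
  proof -
    have "card (lift2 -` X) = card (X - low)"
      using inj_lift2 card_vimage_inj_on_le
      by (metis Diff_eq Int_commute card_image image_vimage_eq inj_on_subset range_lift2 subset_UNIV)
    then show ?thesis
      using that by (metis card_Int_Diff)
  qed
  \<comment> \<open>Stated for arbitrary \<open>J\<close>, since it is applied to images of
    \<open>I\<close> under the swaps.\<close>
  have high: "v \<in> J \<longleftrightarrow> v \<in> ?P"
    if J: "independent_set (quads (2 * Suc k)) qadj J" "card ?P \<le> card J" "v \<notin> low" for J v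
  proof -
    have finJ: "finite J" using J finite_quads finite_subset by (auto simp: independent_set_def)
    have "independent_set (quads (2 * k)) qadj (lift2 -` J)"
      using J(1) by (fastforce simp: independent_set_def quads_def)
    \<comment> \<open>\<open>J\<close> has no more low points than \<open>?P\<close> but at least as
      many points in total, so it has at least as many high ones.\<close>
    moreover have "card (parity_set (2 * k)) \<le> card (lift2 -` J)"
      using split[OF finJ] split[OF finP] J(2) card_low_le[OF J(1)] parity_set_Suc[of k] by simp
    ultimately have "lift2 -` J = lift2 -` ?P"
      using Suc.IH parity_set_Suc by metis
    moreover obtain w where "v = lift2 w" using J(3) range_lift2 by blast
    ultimately show ?thesis by blast
  qed
  have sym: "v \<in> I \<longleftrightarrow> v \<in> ?P" if s: "weight_symmetry s" "s v \<notin> low" for s v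
  proof -
    have inv: "s (s w) = w" and "weight (s w) = weight w" "same_parity (s w) = same_parity w"
      and adj: "qadj (s u) (s w) = qadj u w" for u w
      using s(1) unfolding weight_symmetry_def by blast+
    then have P: "s v \<in> ?P \<longleftrightarrow> v \<in> ?P" and "s w \<in> quads n \<longleftrightarrow> w \<in> quads n" for n w
      by (simp_all add: parity_set_def quads_def)
    then have "independent_set (quads (2 * Suc k)) qadj (s ` I)"
      using Suc.prems(1) adj by (auto simp: independent_set_def)
    moreover have "inj s" by (rule inj_on_inverseI[of _ s]) (rule inv)
    then have "card (s ` I) = card I" using card_image[OF inj_on_subset[OF _ subset_UNIV]] by blast
    ultimately have "s v \<in> s ` I \<longleftrightarrow> s v \<in> ?P"
      using high[of "s ` I" "s v"] Suc.prems(2) s(2) by simp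
    then show ?thesis
      using P inj_image_mem_iff[OF \<open>inj s\<close>] by simp
  qed
  have agree: "(a, b, c, e) \<in> I \<longleftrightarrow> (a, b, c, e) \<in> ?P" if "a \<ge> 2 \<or> b \<ge> 2 \<or> c \<ge> 2 \<or> e \<ge> 2" for a b c e
    using that sym[OF weight_symmetry_swaps(1), of "(a, b, c, e)"]
      sym[OF weight_symmetry_swaps(2), of "(a, b, c, e)"]
      sym[OF weight_symmetry_swaps(3), of "(a, b, c, e)"]
      sym[OF weight_symmetry_swaps(4), of "(a, b, c, e)"]
    by (auto simp: low_def)
  \<comment> \<open>One inclusion is enough: the cardinality hypothesis turns it into
    equality.\<close>
  have "v \<in> ?P" if "v \<in> I" for v
  proof -
    obtain a b c e where v: "v = (a, b, c, e)" by (cases v)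
    have w: "a + b + c + e = 2 * k + 2"
      using that Suc.prems(1) by (auto simp: v independent_set_def quads_def)
    consider "a \<ge> 2 \<or> b \<ge> 2 \<or> c \<ge> 2 \<or> e \<ge> 2" | "a \<le> 1" "b \<le> 1" "c \<le> 1" "e \<le> 1" "k = 1"
      | "a \<le> 1" "b \<le> 1" "c \<le> 1" "e \<le> 1" "k = 0"
    proof (cases "a \<ge> 2 \<or> b \<ge> 2 \<or> c \<ge> 2 \<or> e \<ge> 2")
      case False
      then have "a \<le> 1" "b \<le> 1" "c \<le> 1" "e \<le> 1" by auto
      moreover from this have "k < 2" using w by linarith
      then have "k = 0 \<or> k = 1" by (rule less_2_cases[unfolded One_nat_def[symmetric]])
      ultimately show ?thesis using that by blast
    qed
    then show ?thesis
    proof cases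
      case 1
      then show ?thesis using agree that v by blast
    next
      case 2
      then have "a = 1" "b = 1" "c = 1" "e = 1" using w by linarith+
      then show ?thesis using w by (simp add: v parity_set_def quads_def)
    next
      case 3
      \<comment> \<open>In weight 2, \<open>v\<close> has two entries 1, at least one of them among
        the first three coordinates; doubling that coordinate gives a neighbour of \<open>v\<close>
        in \<open>I\<close>.\<close>
      then have "(2, 0, 0, 0) \<in> I" "(0, 2, 0, 0) \<in> I" "(0, 0, 2, 0) \<in> I"
        by (simp_all add: agree parity_set_def quads_def)
      then have "\<not> qadj (2, 0, 0, 0) v" "\<not> qadj (0, 2, 0, 0) v" "\<not> qadj (0, 0, 2, 0) v"
        using that Suc.prems(1) by (auto simp: independent_set_def)
      then have False using 3 w by (auto simp: v max_def split: if_splits)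
      then show ?thesis ..
    qed
  qed
  then show ?case using finP Suc.prems(2) by (intro card_seteq) auto
qed

lemma maximum_independent_quads:
  assumes "even d"
  shows "{I. maximum_independent_set (quads d) qadj I} = {parity_set d}"
proof -
  obtain k where d: "d = 2 * k" using assms by blast
  \<comment> \<open>A larger \<open>J\<close> would have to equal the parity set, which is
    absurd.\<close>
  have le: "card J \<le> card (parity_set d)" if "independent_set (quads d) qadj J" for J
    using independent_parity_unique[of k J] that d by (cases "card J \<le> card (parity_set d)") auto
  have "maximum_independent_set (quads d) qadj (parity_set d)"
    using le independent_parity_set by (simp add: maximum_independent_set_def)
  moreover have "I = parity_set d" if "maximum_independent_set (quads d) qadj I" for I
    using that independent_parity_set independent_parity_unique[of k I] d
    by (simp add: maximum_independent_set_def)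
  ultimately show ?thesis by blast
qed

section \<open>Transport along a graph isomorphism\<close>

lemma independent_set_image_iff:
  assumes "bij_betw h V W" "\<And>u v. u \<in> V \<Longrightarrow> v \<in> V \<Longrightarrow> adj' (h u) (h v) \<longleftrightarrow> adj u v" "I \<subseteq> V"
  shows "independent_set W adj' (h ` I) \<longleftrightarrow> independent_set V adj I"
  using assms by (auto simp: independent_set_def bij_betw_def subset_iff)

lemma maximum_independent_set_image:
  assumes h: "bij_betw h V W" and adj: "\<And>u v. u \<in> V \<Longrightarrow> v \<in> V \<Longrightarrow> adj' (h u) (h v) \<longleftrightarrow> adj u v"
  shows "{J. maximum_independent_set W adj' J} = image h ` {I. maximum_independent_set V adj I}"
proof -
  have ind: "independent_set W adj' (h ` I) \<longleftrightarrow> independent_set V adj I" if "I \<subseteq> V" for I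
    using h adj that by (rule independent_set_image_iff)
  have card: "card (h ` I) = card I" if "I \<subseteq> V" for I
    using h that by (meson bij_betw_def card_image inj_on_subset)
  \<comment> \<open>Every independent \<open>J\<close> in \<open>W\<close> is the image of a subset
    of \<open>V\<close> of the same size, so both graphs have the same size bounds.\<close>
  have all: "(\<forall>J. independent_set W adj' J \<longrightarrow> card J \<le> n) \<longleftrightarrow>
      (\<forall>I. independent_set V adj I \<longrightarrow> card I \<le> n)" for n
  proof safe
    fix I assume "\<forall>J. independent_set W adj' J \<longrightarrow> card J \<le> n" "independent_set V adj I"
    then show "card I \<le> n" using ind[of I] card[of I] by (metis independent_set_def)
  next
    fix J assume a: "\<forall>I. independent_set V adj I \<longrightarrow> card I \<le> n" "independent_set W adj' J"
    then obtain I where "I \<subseteq> V" "J = h ` I"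
      using h by (metis bij_betw_def independent_set_def subset_imageE)
    then show "card J \<le> n" using a ind[of I] card[of I] by metis
  qed
  have max: "maximum_independent_set W adj' (h ` I) \<longleftrightarrow> maximum_independent_set V adj I"
    if "I \<subseteq> V" for I
    using ind[OF that] card[OF that] all by (simp add: maximum_independent_set_def)
  show ?thesis
  proof (intro equalityI subsetI)
    fix J assume J: "J \<in> {J. maximum_independent_set W adj' J}"
    then obtain I where "I \<subseteq> V" "J = h ` I"
      using h by (metis bij_betw_def independent_set_def maximum_independent_set_def mem_Collect_eq subset_imageE)
    then show "J \<in> image h ` {I. maximum_independent_set V adj I}" using J max by blast
  next
    fix J assume "J \<in> image h ` {I. maximum_independent_set V adj I}"
    then obtain I where "maximum_independent_set V adj I" "J = h ` I" by blast
    then show "J \<in> {J. maximum_independent_set W adj' J}"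
      using max by (auto simp: maximum_independent_set_def independent_set_def)
  qed
qed

section \<open>Monomials in four variables as quadruples\<close>

fun exponents :: "quad \<Rightarrow> nat \<Rightarrow>\<^sub>0 nat" where
  "exponents (a, b, c, e) = Poly_Mapping.single 1 a + Poly_Mapping.single 2 b
     + Poly_Mapping.single 3 c + Poly_Mapping.single 4 e"

lemma interval_1_4: "{1..4::nat} = {1, 2, 3, 4}"
  by auto

lemma lookup_exponents:
  "Poly_Mapping.lookup (exponents (a, b, c, e)) i =
     (if i = 1 then a else if i = 2 then b else if i = 3 then c else if i = 4 then e else 0)"
  by (simp add: lookup_add lookup_single when_def)

lemma monomials_4_eq:
  "(monomials 4 d :: 'a::field mpoly set) = (\<lambda>v. Poly_Mapping.single (exponents v) 1) ` quads d"
proof (intro equalityI subsetI)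
  fix f :: "'a mpoly" assume "f \<in> monomials 4 d"
  then obtain \<alpha> where \<alpha>: "f = Poly_Mapping.single \<alpha> 1" "Poly_Mapping.keys \<alpha> \<subseteq> {1..4}"
    "(\<Sum>i=1..4. Poly_Mapping.lookup \<alpha> i) = d"
    by (auto simp: monomials_def)
  let ?l = "Poly_Mapping.lookup \<alpha>"
  define v where "v = (?l 1, ?l 2, ?l 3, ?l 4)"
  have "?l i = 0" if "i \<notin> {1, 2, 3, 4}" for i
    using \<alpha>(2) that unfolding interval_1_4 by (auto simp: in_keys_iff subset_iff)
  then have "\<alpha> = exponents v"
    unfolding v_def by (intro poly_mapping_eqI) (simp del: exponents.simps add: lookup_exponents)
  moreover have "v \<in> quads d" using \<alpha>(3) unfolding interval_1_4 by (simp add: quads_def v_def)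
  ultimately show "f \<in> (\<lambda>v. Poly_Mapping.single (exponents v) 1) ` quads d"
    unfolding \<alpha>(1) by (intro image_eqI[of _ _ v]) simp_all
next
  fix f :: "'a mpoly" assume "f \<in> (\<lambda>v. Poly_Mapping.single (exponents v) 1) ` quads d"
  then obtain a b c e where f: "f = Poly_Mapping.single (exponents (a, b, c, e)) 1"
    "a + b + c + e = d" by (auto simp: quads_def simp del: exponents.simps)
  have "Poly_Mapping.keys (exponents (a, b, c, e)) \<subseteq> {1..4}"
    unfolding interval_1_4
    by (auto simp: in_keys_iff lookup_exponents simp del: exponents.simps split: if_splits)
  moreover have "(\<Sum>i=1..4. Poly_Mapping.lookup (exponents (a, b, c, e)) i) = d"
    unfolding interval_1_4 lookup_exponents using f(2) by simp
  ultimately show "f \<in> monomials 4 d" using f(1) by (auto simp: monomials_def simp del: exponents.simps)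
qed

lemma inj_exponents: "inj exponents"
proof (rule injI)
  fix u v assume "exponents u = exponents v"
  then have "Poly_Mapping.lookup (exponents u) i = Poly_Mapping.lookup (exponents v) i" for i by simp
  from this[of 1] this[of 2] this[of 3] this[of 4] show "u = v"
    by (cases u; cases v) (simp add: lookup_exponents del: exponents.simps)
qed

lemma bij_quads_monomials:
  "bij_betw (\<lambda>v. Poly_Mapping.single (exponents v) (1::'a::field)) (quads d) (monomials 4 d)"
proof -
  have "inj (\<lambda>v. Poly_Mapping.single (exponents v) (1::'a))"
    using inj_exponents by (intro injI) (metis injD keys_single one_neq_zero singleton_inject)
  then show ?thesis
    unfolding monomials_4_eq by (meson bij_betw_imageI inj_on_subset subset_UNIV)
qed

text \<open>For \<open>u\<close> in \<open>quads d\<close> the bound \<open>d + 1\<close> of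
  \<open>adjacent_iff\<close> is the successor of the weight of \<open>u\<close>, as in
  \<open>qadj\<close>.\<close>

lemma adjacent_iff_qadj:
  assumes "u \<in> quads d" "v \<in> quads d"
  shows "adjacent 4 d (Poly_Mapping.single (exponents u) (1::'a::field))
      (Poly_Mapping.single (exponents v) 1) \<longleftrightarrow> qadj u v"
proof -
  have "Poly_Mapping.single (exponents w) (1::'a) \<in> monomials 4 d" if "w \<in> quads d" for w
    using that unfolding monomials_4_eq by blast
  note iff = adjacent_iff[OF this[OF assms(1)] this[OF assms(2)]]
  show ?thesis
    unfolding iff interval_1_4 using assms
    by (cases u; cases v) (simp add: lookup_exponents quads_def add_ac del: exponents.simps)
qed

theorem theorem3p1:
  fixes d :: nat
  assumes "even d"
  shows "num_max_indep TYPE('a::field) 4 d = 1"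
proof -
  have "{I :: 'a mpoly set. maximum_independent_set (monomials 4 d) (adjacent 4 d) I} =
      image (\<lambda>v. Poly_Mapping.single (exponents v) 1) ` {parity_set d}"
    \<comment> \<open>Rewriting the singleton back into the family of maximum independent sets
      brings the goal into the form of the transport lemma.\<close>
    unfolding maximum_independent_quads[OF assms, symmetric]
    using bij_quads_monomials adjacent_iff_qadj by (rule maximum_independent_set_image)
  then show ?thesis by (simp add: num_max_indep_def)
qed

end
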